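(* Let $n\ge1$ and $x=(x_1,\ldots,x_n)\in\mathbb R^n$. For the Min matrix $A_{\min}(x)=\bigl(x_{\min(i,j)}\bigr)_{i,j=1}^n$, the following are equivalent: 1. $0<x_1<x_2<\cdots<x_n$. 2. $A_{\min}(x)$ is positive definite. 3. $A_{\min}(x)$ is nonsingular and totally nonnegative. 4. $A_{\min}(x)$ is a nonsingular inverse $M$-matrix. 5. $A_{\min}(x)$ is oscillatory. Likewise, for the Max matrix $A_{\max}(x)=\bigl(x_{\max(i,j)}\bigr)_{i,j=1}^n$, the following are equivalent: $x_1>x_2>\cdots>x_n>0$; $A_{\max}(x)$ is positive definite; $A_{\max}(x)$ is nonsingular and totally nonnegative; $A_{\max}(x)$ is a nonsingular inverse $M$-matrix; $A_{\max}(x)$ is oscillatory.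
   Context: A real matrix is totally nonnegative if all its minors (of all orders) are nonnegative, and totally positive if all its minors of all orders are positive. A totally nonnegative square matrix $A$ is oscillatory if there is a positive integer $m$ such that $A^m$ is totally positive. A $Z$-matrix is a real square matrix whose off-diagonal entries are nonpositive. A nonsingular $M$-matrix is a nonsingular $Z$-matrix whose inverse is entrywise nonnegative. A matrix $A$ is a nonsingular inverse $M$-matrix if $A$ is nonsingular and $A^{-1}$ is a nonsingular $M$-matrix. *)

theory Defs
  imports "Jordan_Normal_Form.Determinant" "Jordan_Normal_Form.DL_Submatrix"
begin

text \<open>Vectors and matrices are indexed from 0, so the entry \<open>x\<^sub>i\<close> of the mathematical text is
  \<^term>\<open>x $ (i - 1)\<close>.\<close>

definition min_matrix :: "real vec \<Rightarrow> real mat" where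
  "min_matrix x = mat (dim_vec x) (dim_vec x) (\<lambda>(i, j). x $ min i j)"

definition max_matrix :: "real vec \<Rightarrow> real mat" where
  "max_matrix x = mat (dim_vec x) (dim_vec x) (\<lambda>(i, j). x $ max i j)"

text \<open>Positive definiteness of a real matrix includes symmetry.\<close>

definition positive_definite :: "real mat \<Rightarrow> bool" where
  "positive_definite A \<longleftrightarrow> square_mat A \<and> transpose_mat A = A \<and>
     (\<forall>v \<in> carrier_vec (dim_row A). v \<noteq> 0\<^sub>v (dim_row A) \<longrightarrow> 0 < v \<bullet> (A *\<^sub>v v))"

text \<open>The minors of \<open>A\<close> are the determinants of its square submatrices of order at least 1.
  \<^const>\<open>submatrix\<close> ignores indices out of range, so the index sets are restricted to the valid ones
  for \<open>card I = card J\<close> to mean that the submatrix is square.\<close>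

definition minors :: "real mat \<Rightarrow> real set" where
  "minors A = {det (submatrix A I J) | I J.
     I \<subseteq> {..<dim_row A} \<and> J \<subseteq> {..<dim_col A} \<and> card I = card J \<and> 1 \<le> card I}"

definition totally_nonnegative :: "real mat \<Rightarrow> bool" where
  "totally_nonnegative A \<longleftrightarrow> (\<forall>d \<in> minors A. 0 \<le> d)"

definition totally_positive :: "real mat \<Rightarrow> bool" where
  "totally_positive A \<longleftrightarrow> (\<forall>d \<in> minors A. 0 < d)"

definition oscillatory :: "real mat \<Rightarrow> bool" where
  "oscillatory A \<longleftrightarrow> square_mat A \<and> totally_nonnegative A \<and>
     (\<exists>m::nat. 0 < m \<and> totally_positive (A ^\<^sub>m m))"

definition Z_matrix :: "real mat \<Rightarrow> bool" where
  "Z_matrix A \<longleftrightarrow> square_mat A \<and>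
     (\<forall>i < dim_row A. \<forall>j < dim_col A. i \<noteq> j \<longrightarrow> A $$ (i, j) \<le> 0)"

definition entrywise_nonnegative :: "real mat \<Rightarrow> bool" where
  "entrywise_nonnegative A \<longleftrightarrow> (\<forall>i < dim_row A. \<forall>j < dim_col A. 0 \<le> A $$ (i, j))"

text \<open>In the next two definitions the witness \<open>B\<close> is the (unique) inverse of \<open>A\<close>, as in
  \<^const>\<open>invertible_mat\<close>; its existence also expresses nonsingularity.\<close>

definition nonsingular_M_matrix :: "real mat \<Rightarrow> bool" where
  "nonsingular_M_matrix A \<longleftrightarrow> Z_matrix A \<and>
     (\<exists>B. inverts_mat A B \<and> inverts_mat B A \<and> entrywise_nonnegative B)"

definition nonsingular_inverse_M_matrix :: "real mat \<Rightarrow> bool" where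
  "nonsingular_inverse_M_matrix A \<longleftrightarrow> square_mat A \<and>
     (\<exists>B. inverts_mat A B \<and> inverts_mat B A \<and> nonsingular_M_matrix B)"

end

theory Submission
  imports Defs
begin

text \<open>Put \<open>d\<^sub>0 = x\<^sub>0\<close> and \<open>d\<^sub>i = x\<^sub>i - x\<^sub>i\<^sub>-\<^sub>1\<close>. The condition \<open>0 < x\<^sub>0 < x\<^sub>1 < \<dots>\<close> says that all \<open>d\<^sub>i\<close>
  are positive, and the Min matrix factors as \<open>U\<^sup>T D U\<close>, where \<open>U\<close> is the upper triangular
  matrix of ones and \<open>D\<close> is the diagonal matrix of the \<open>d\<^sub>i\<close>
  (\<open>min_matrix_factorization\<close>). Hence the Min matrix is positive definite iff all \<open>d\<^sub>i\<close> are
  positive, and invertible iff no \<open>d\<^sub>i\<close> vanishes. Its inverse \<open>W D\<^sup>-\<^sup>1 W\<^sup>T\<close>, with the bidiagonal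
  difference matrix \<open>W = U\<^sup>-\<^sup>1\<close>, has the off-diagonal entries \<open>- 1 / d\<^sub>i\<close> with \<open>i \<ge> 1\<close> and zeros, which
  settles the M-matrix condition up to the sign of \<open>d\<^sub>0\<close>, an entry of the Min matrix.

  The minors of the Min matrix have a product formula (\<open>det_min_kernel\<close>): with rows
  \<open>i\<^sub>0 < i\<^sub>1 < \<dots>\<close> and columns \<open>j\<^sub>0 < j\<^sub>1 < \<dots>\<close>, the minor is zero unless
  \<open>max i\<^sub>a j\<^sub>a < min i\<^sub>a\<^sub>+\<^sub>1 j\<^sub>a\<^sub>+\<^sub>1\<close> for all \<open>a\<close>, and otherwise it is a product of one entry of \<open>x\<close> and
  of differences of entries of \<open>x\<close> at increasing positions. For positive \<open>d\<^sub>i\<close> it is therefore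
  nonnegative, and positive in the interlacing case. Conversely, total nonnegativity and
  invertibility force positive \<open>d\<^sub>i\<close> through the minors of order 1 and 2.

  For oscillation, the Cauchy-Binet formula (\<open>Cauchy_Binet\<close>) turns a chain of index sets, with
  a positive minor between any two neighbours, into a positive minor of a power
  (\<open>minor_pow_pos_of_chain\<close>). Every index set of size \<open>k\<close> is joined to \<open>{0, \<dots>, k - 1}\<close> by moving
  one index at a time, so the power \<open>2 n\<close> is totally positive. Conversely, the determinant of a
  totally positive power is nonzero, so an oscillatory matrix is invertible and totally nonnegative.

  The Max matrix of \<open>x\<close> is the Min matrix of the reversed vector with rows and columns reversed,
  and this reversal preserves all the properties in question.\<close>

section \<open>Minors and the Cauchy-Binet formula\<close>

text \<open>A square submatrix is given here by the increasing enumerations of its row and column indices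
  instead of the two index sets. Increasing functions can be shifted, reversed and deformed entry by
  entry, and that is what the proofs below do with them. Only the values on \<open>{..<k}\<close> matter.\<close>
definition index_seq :: "nat \<Rightarrow> nat \<Rightarrow> (nat \<Rightarrow> nat) \<Rightarrow> bool" where
  "index_seq k n f \<longleftrightarrow> strict_mono_on {..<k} f \<and> f ` {..<k} \<subseteq> {..<n}"

definition minor :: "'a :: comm_ring_1 mat \<Rightarrow> nat \<Rightarrow> (nat \<Rightarrow> nat) \<Rightarrow> (nat \<Rightarrow> nat) \<Rightarrow> 'a" where
  "minor A k f g = det (mat k k (\<lambda>(a, b). A $$ (f a, g b)))"

lemma index_seqD:
  assumes "index_seq k n f"
  shows "a < k \<Longrightarrow> f a < n" and "a < b \<Longrightarrow> b < k \<Longrightarrow> f a < f b"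
  using assms by (auto simp: index_seq_def strict_mono_on_def)

lemma index_seqI:
  assumes "\<And>a. a < k \<Longrightarrow> f a < n" and "\<And>a b. a < b \<Longrightarrow> b < k \<Longrightarrow> f a < f b"
  shows "index_seq k n f"
  using assms by (auto simp: index_seq_def strict_mono_on_def)

lemma index_seq_inj: "index_seq k n f \<Longrightarrow> inj_on f {..<k}"
  unfolding index_seq_def by (blast intro: strict_mono_on_imp_inj_on)

lemma minor_cong:
  assumes "\<And>a. a < k \<Longrightarrow> f a = f' a" and "\<And>a. a < k \<Longrightarrow> g a = g' a"
  shows "minor A k f g = minor A k f' g'"
  unfolding minor_def by (rule arg_cong[of _ _ det], rule eq_matI) (auto simp: assms)

lemma index_seq_pick:
  assumes "K \<subseteq> {..<n}" 
  shows "index_seq (card K) n (pick K)"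
  by (rule index_seqI) (use assms pick_in_set_le pick_mono_le in blast)+

text \<open>The enumeration of a finite set of naturals in increasing order is unique, so passing from an
  increasing function to its range and back loses nothing.\<close>
lemma pick_image:
  assumes f: "index_seq k n f" and a: "a < k"
  shows "pick (f ` {..<k}) a = f a"
proof -
  have mono: "f b < f c \<longleftrightarrow> b < c" if "b < k" "c < k" for b c
    using f that unfolding index_seq_def
    by (metis lessThan_iff strict_mono_on_less)
  have "{b \<in> f ` {..<k}. b < f a} = f ` {..<a}"
    using a mono by (auto simp: image_iff intro: less_trans)
  moreover have "card (f ` {..<a}) = a"
    using index_seq_inj[OF f] a by (subst card_image) (auto intro: inj_on_subset)
  ultimately show ?thesis
    using pick_card_in_set[of "f a" "f ` {..<k}"] a by auto
qed

lemma minors_eq: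
  "minors A = {minor A k f g | k f g.
     1 \<le> k \<and> index_seq k (dim_row A) f \<and> index_seq k (dim_col A) g}" (is "_ = ?R")
proof (intro subset_antisym subsetI)
  have sub: "submatrix A I J = mat (card I) (card J) (\<lambda>(a, b). A $$ (pick I a, pick J b))"
    if "I \<subseteq> {..<dim_row A}" "J \<subseteq> {..<dim_col A}" for I J
  proof -
    have "{i. i < dim_row A \<and> i \<in> I} = I" "{j. j < dim_col A \<and> j \<in> J} = J" using that by auto
    then show ?thesis by (simp add: submatrix_def)
  qed
  {
    fix d assume "d \<in> minors A"
    then obtain I J where *: "d = det (submatrix A I J)" "I \<subseteq> {..<dim_row A}" "J \<subseteq> {..<dim_col A}"
        "card I = card J" "1 \<le> card I"
      unfolding minors_def by blast
    then have "d = minor A (card I) (pick I) (pick J)" by (simp add: sub minor_def)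
    with * index_seq_pick[of I "dim_row A"] index_seq_pick[of J "dim_col A"] show "d \<in> ?R"
      unfolding mem_Collect_eq
      by (intro exI[of _ "card I"] exI[of _ "pick I"] exI[of _ "pick J"]) simp
  }
  fix d assume "d \<in> ?R"
  then obtain k f g where *: "d = minor A k f g" "1 \<le> k" "index_seq k (dim_row A) f"
      "index_seq k (dim_col A) g" by blast
  let ?I = "f ` {..<k}" and ?J = "g ` {..<k}"
  have c: "card ?I = k" "card ?J = k"
    using * index_seq_inj by (auto simp: card_image)
  have s: "?I \<subseteq> {..<dim_row A}" "?J \<subseteq> {..<dim_col A}" using * by (auto simp: index_seq_def)
  have "d = minor A k (pick ?I) (pick ?J)"
    unfolding *(1) using * by (intro minor_cong) (simp_all add: pick_image)
  also have "\<dots> = det (submatrix A ?I ?J)" using sub[OF s] c by (simp add: minor_def)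
  finally show "d \<in> minors A" unfolding minors_def mem_Collect_eq
    using s c *(2) by (intro exI[of _ ?I] exI[of _ ?J]) simp
qed

lemma totally_nonnegative_iff_minor:
  "totally_nonnegative A \<longleftrightarrow> (\<forall>k f g. 1 \<le> k \<longrightarrow> index_seq k (dim_row A) f \<longrightarrow>
     index_seq k (dim_col A) g \<longrightarrow> 0 \<le> minor A k f g)"
  unfolding totally_nonnegative_def minors_eq by blast

lemma totally_positive_iff_minor:
  "totally_positive A \<longleftrightarrow> (\<forall>k f g. 1 \<le> k \<longrightarrow> index_seq k (dim_row A) f \<longrightarrow>
     index_seq k (dim_col A) g \<longrightarrow> 0 < minor A k f g)"
  unfolding totally_positive_def minors_eq by blast

lemma minor_full:
  assumes "A \<in> carrier_mat n n" shows "minor A n id id = det A"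
  unfolding minor_def by (rule arg_cong[of _ _ det], rule eq_matI) (use assms in auto)

text \<open>Fixing the range \<open>K\<close> of \<open>h\<close> and one enumeration \<open>e\<close> of it, the functions \<open>h\<close> are the
  compositions of \<open>e\<close> with a permutation \<open>p\<close>. Such a permutation multiplies the second determinant
  by its sign, and the signed products of the entries of \<open>P\<close> then add up to the first one.\<close>
lemma sum_over_enumerations_of_set:
  fixes P :: "nat \<Rightarrow> nat \<Rightarrow> 'a :: comm_ring_1"
  assumes e: "bij_betw e {0..<k} K"
  shows "(\<Sum>h | h \<in> {0..<k} \<rightarrow>\<^sub>E UNIV \<and> bij_betw h {0..<k} K.
            (\<Prod>a = 0..<k. P a (h a)) * det (mat k k (\<lambda>(a, b). Q (h a) b)))
       = det (mat k k (\<lambda>(a, b). P a (e b))) * det (mat k k (\<lambda>(a, b). Q (e a) b))"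
    (is "?L = _")
proof -
  let ?B = "mat k k (\<lambda>(a, b). Q (e a) b)"
  let ?inv = "\<lambda>h a. if a < k then inv_into {0..<k} e (h a) else a"
  have einv: "inv_into {0..<k} e (e a) = a" if "a < k" for a
    using e that by (auto simp: bij_betw_def inv_into_f_f)
  have inve: "e (inv_into {0..<k} e y) = y" if "y \<in> K" for y
    using bij_betw_inv_into_right[OF e that] .
  have "?L = (\<Sum>p | p permutes {0..<k}. (\<Prod>a = 0..<k. P a (e (p a))) * (signof p * det ?B))"
  proof (rule sum.reindex_bij_witness[where i = "\<lambda>p. restrict (e \<circ> p) {0..<k}" and j = ?inv])
    fix h assume "h \<in> {h. h \<in> {0..<k} \<rightarrow>\<^sub>E UNIV \<and> bij_betw h {0..<k} K}"
    then have h: "h \<in> {0..<k} \<rightarrow>\<^sub>E UNIV" "bij_betw h {0..<k} K" by auto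
    have hK: "h a \<in> K" if "a < k" for a using h(2) that by (auto simp: bij_betw_def)
    have ehinv: "e (?inv h a) = h a" if "a < k" for a using inve hK that by simp
    show "restrict (e \<circ> ?inv h) {0..<k} = h"
      using h(1) ehinv by (auto simp: restrict_def PiE_def extensional_def)
    have "bij_betw (inv_into {0..<k} e \<circ> h) {0..<k} {0..<k}"
      using bij_betw_trans[OF h(2) bij_betw_inv_into[OF e]] .
    then have "bij_betw (?inv h) {0..<k} {0..<k}"
      by (rule bij_betw_cong[THEN iffD1, rotated]) auto
    then have perm: "?inv h permutes {0..<k}" by (rule bij_imp_permutes) auto
    then show "?inv h \<in> {p. p permutes {0..<k}}" by simp
    have "mat k k (\<lambda>(a, b). Q (h a) b) = mat k k (\<lambda>(a, b). ?B $$ (?inv h a, b))"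
    proof (rule eq_matI)
      fix a b assume "a < dim_row (mat k k (\<lambda>(a, b). ?B $$ (?inv h a, b)))"
        "b < dim_col (mat k k (\<lambda>(a, b). ?B $$ (?inv h a, b)))"
      then have ab: "a < k" "b < k" by auto
      then have "?inv h a < k" using permutes_in_image[OF perm, of a] by auto
      then show "mat k k (\<lambda>(a, b). Q (h a) b) $$ (a, b) = mat k k (\<lambda>(a, b). ?B $$ (?inv h a, b)) $$ (a, b)"
        using ab ehinv[OF ab(1)] by simp
    qed auto
    then have "det (mat k k (\<lambda>(a, b). Q (h a) b)) = signof (?inv h) * det ?B"
      using det_permute_rows[OF _ perm, of ?B] by simp
    moreover have "(\<Prod>a = 0..<k. P a (e (?inv h a))) = (\<Prod>a = 0..<k. P a (h a))"
      by (rule prod.cong) (use ehinv in auto)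
    ultimately show "(\<Prod>a = 0..<k. P a (e (?inv h a))) * (signof (?inv h) * det ?B)
        = (\<Prod>a = 0..<k. P a (h a)) * det (mat k k (\<lambda>(a, b). Q (h a) b))" by simp
  next
    fix p assume "p \<in> {p. p permutes {0..<k}}"
    then have p: "p permutes {0..<k}" by simp
    have pk: "p a < k" if "a < k" for a using permutes_in_image[OF p, of a] that by simp
    show "?inv (restrict (e \<circ> p) {0..<k}) = p"
      using einv pk permutes_not_in[OF p] by (auto simp: fun_eq_iff)
    have "bij_betw (e \<circ> p) {0..<k} K"
      using bij_betw_trans[OF permutes_imp_bij[OF p] e] .
    then show "restrict (e \<circ> p) {0..<k} \<in> {h. h \<in> {0..<k} \<rightarrow>\<^sub>E UNIV \<and> bij_betw h {0..<k} K}"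
      by (auto simp: bij_betw_restrict_eq)
  qed
  also have "\<dots> = (\<Sum>p | p permutes {0..<k}. signof p * (\<Prod>a = 0..<k. P a (e (p a)))) * det ?B"
    unfolding sum_distrib_right by (rule sum.cong) (simp_all only: mult_ac)
  also have "(\<Sum>p | p permutes {0..<k}. signof p * (\<Prod>a = 0..<k. P a (e (p a))))
      = det (mat k k (\<lambda>(a, b). P a (e b)))"
    unfolding det_def'[OF mat_carrier]
    by (intro sum.cong refl arg_cong2[where f = "(*)"] prod.cong)
       (auto dest: permutes_in_image)
  finally show ?thesis .
qed

text \<open>Expanding every entry of the product in the Leibniz formula gives a sum over all functions \<open>h\<close>
  that choose an intermediate index for each row. A repeated choice produces two equal rows;
  the injective choices are collected according to their range \<open>K\<close>.\<close>
lemma Cauchy_Binet: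
  fixes A B :: "'a :: comm_ring_1 mat"
  assumes A: "A \<in> carrier_mat l n" and B: "B \<in> carrier_mat n m"
    and f: "index_seq k l f" and g: "index_seq k m g"
  shows "minor (A * B) k f g
       = (\<Sum>K | K \<subseteq> {..<n} \<and> card K = k. minor A k f (pick K) * minor B k (pick K) g)"
proof -
  let ?P = "\<lambda>a c. A $$ (f a, c)" and ?Q = "\<lambda>c b. B $$ (c, g b)"
  let ?H = "{0..<k} \<rightarrow>\<^sub>E {..<n}"
  let ?Ks = "{K. K \<subseteq> {..<n} \<and> card K = k}"
  let ?t = "\<lambda>h. (\<Prod>a = 0..<k. ?P a (h a)) * det (mat k k (\<lambda>(a, b). ?Q (h a) b))"
  have finH: "finite ?H" by (auto intro: finite_PiE)
  have finK: "finite ?Ks" by (rule finite_subset[of _ "Pow {..<n}"]) auto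
  \<comment> \<open>\<open>h a\<close> is the intermediate index chosen in row \<open>a\<close>.\<close>
  have "minor (A * B) k f g = det (mat k k (\<lambda>(a, b). \<Sum>c<n. ?P a c * ?Q c b))"
    unfolding minor_def
    by (rule arg_cong[of _ _ det], rule eq_matI)
       (use A B index_seqD[OF f] index_seqD[OF g] in
         \<open>auto simp: scalar_prod_def atLeast0LessThan intro!: sum.cong\<close>)
  also have "\<dots> = (\<Sum>p | p permutes {0..<k}. signof p *
      (\<Prod>a = 0..<k. \<Sum>c<n. ?P a c * ?Q c (p a)))"
    unfolding det_def'[OF mat_carrier]
    by (intro sum.cong refl arg_cong2[where f = "(*)"] prod.cong)
       (auto dest: permutes_in_image)
  also have "\<dots> = (\<Sum>p | p permutes {0..<k}. \<Sum>h\<in>?H. signof p *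
      (\<Prod>a = 0..<k. ?P a (h a) * ?Q (h a) (p a)))"
    by (subst prod_sum_PiE) (auto simp: sum_distrib_left)
  also have "\<dots> = (\<Sum>h\<in>?H. \<Sum>p | p permutes {0..<k}. signof p *
      (\<Prod>a = 0..<k. ?P a (h a) * ?Q (h a) (p a)))"
    by (rule sum.swap)
  also have "\<dots> = (\<Sum>h\<in>?H. ?t h)"
  proof (rule sum.cong[OF refl])
    fix h
    have "det (mat k k (\<lambda>(a, b). ?Q (h a) b))
        = (\<Sum>p | p permutes {0..<k}. signof p * (\<Prod>a = 0..<k. ?Q (h a) (p a)))"
      unfolding det_def'[OF mat_carrier]
      by (intro sum.cong refl arg_cong2[where f = "(*)"] prod.cong)
         (auto dest: permutes_in_image)
    then show "(\<Sum>p | p permutes {0..<k}. signof p *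
        (\<Prod>a = 0..<k. ?P a (h a) * ?Q (h a) (p a))) = ?t h"
      by (simp add: prod.distrib sum_distrib_left mult_ac)
  qed
  \<comment> \<open>A choice that is not injective repeats a row of the second factor.\<close>
  also have "\<dots> = (\<Sum>h | h \<in> ?H \<and> inj_on h {0..<k}. ?t h)"
  proof (rule sum.mono_neutral_right[OF finH]; (intro ballI)?)
    fix h assume "h \<in> ?H - {h \<in> ?H. inj_on h {0..<k}}"
    then obtain a b where ab: "a < k" "b < k" "a \<noteq> b" "h a = h b" by (auto simp: inj_on_def)
    have "det (mat k k (\<lambda>(a, b). ?Q (h a) b)) = 0"
      by (rule det_identical_rows[OF mat_carrier ab(3,1,2)])
         (use ab in \<open>auto intro!: eq_vecI\<close>)
    then show "?t h = 0" by simp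
  qed auto
  also have "\<dots> = (\<Sum>K\<in>?Ks. \<Sum>h | h \<in> {h. h \<in> ?H \<and> inj_on h {0..<k}} \<and> h ` {0..<k} = K. ?t h)"
  proof (rule sum.group[symmetric])
    show "(\<lambda>h. h ` {0..<k}) ` {h \<in> ?H. inj_on h {0..<k}} \<subseteq> ?Ks"
      by (auto simp: card_image)
  qed (use finH finK in auto)
  also have "\<dots> = (\<Sum>K\<in>?Ks. minor A k f (pick K) * minor B k (pick K) g)"
  proof (rule sum.cong[OF refl])
    fix K assume "K \<in> ?Ks"
    then have K: "K \<subseteq> {..<n}" "card K = k" by auto
    have "bij_betw (pick K) {0..<k} K"
      unfolding bij_betw_def
    proof
      show inj: "inj_on (pick K) {0..<k}"
        using index_seq_inj[OF index_seq_pick[OF K(1)]] K(2) by (simp add: atLeast0LessThan)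
      have "pick K ` {0..<k} \<subseteq> K" using K(2) pick_in_set_le by auto
      then show "pick K ` {0..<k} = K"
        using K inj by (intro card_subset_eq) (auto simp: card_image finite_subset)
    qed
    from sum_over_enumerations_of_set[OF this, of ?P ?Q]
    have "(\<Sum>h | h \<in> {0..<k} \<rightarrow>\<^sub>E UNIV \<and> bij_betw h {0..<k} K. ?t h)
        = minor A k f (pick K) * minor B k (pick K) g" unfolding minor_def .
    moreover have "{h. h \<in> {h. h \<in> ?H \<and> inj_on h {0..<k}} \<and> h ` {0..<k} = K}
        = {h. h \<in> {0..<k} \<rightarrow>\<^sub>E UNIV \<and> bij_betw h {0..<k} K}"
      using K(1) by (auto simp: bij_betw_def PiE_iff)
    ultimately show "(\<Sum>h | h \<in> {h. h \<in> ?H \<and> inj_on h {0..<k}} \<and> h ` {0..<k} = K. ?t h)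
        = minor A k f (pick K) * minor B k (pick K) g" by simp
  qed
  finally show ?thesis .
qed

section \<open>Products and powers of totally nonnegative matrices\<close>

lemma totally_nonnegative_mult:
  assumes A: "A \<in> carrier_mat l n" and B: "B \<in> carrier_mat n m"
    and "totally_nonnegative A" and "totally_nonnegative B"
  shows "totally_nonnegative (A * B)"
  unfolding totally_nonnegative_iff_minor
proof (intro allI impI)
  fix k f g assume k: "1 \<le> k"
    and "index_seq k (dim_row (A * B)) f" "index_seq k (dim_col (A * B)) g"
  then have f: "index_seq k l f" and g: "index_seq k m g" using A B by auto
  have "0 \<le> minor A k f (pick K) * minor B k (pick K) g" if "K \<subseteq> {..<n}" "card K = k" for K
    using assms k f g index_seq_pick[OF that(1)] that(2)
    unfolding totally_nonnegative_iff_minor by (intro mult_nonneg_nonneg) auto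
  then show "0 \<le> minor (A * B) k f g"
    unfolding Cauchy_Binet[OF A B f g] by (intro sum_nonneg) auto
qed

text \<open>All terms of the Cauchy-Binet sum are nonnegative, so one positive term suffices.\<close>
lemma minor_mult_pos:
  assumes A: "A \<in> carrier_mat l n" and B: "B \<in> carrier_mat n m"
    and "totally_nonnegative A" and "totally_nonnegative B" and k: "1 \<le> k"
    and f: "index_seq k l f" and h: "index_seq k n h" and g: "index_seq k m g"
    and "0 < minor A k f h" and "0 < minor B k h g"
  shows "0 < minor (A * B) k f g"
  unfolding Cauchy_Binet[OF A B f g]
proof (rule sum_pos2)
  let ?K = "h ` {..<k}"
  show "finite {K. K \<subseteq> {..<n} \<and> card K = k}"
    by (rule finite_subset[of _ "Pow {..<n}"]) auto
  show "?K \<in> {K. K \<subseteq> {..<n} \<and> card K = k}"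
    using h index_seq_inj[OF h] by (auto simp: index_seq_def card_image)
  have "minor A k f (pick ?K) = minor A k f h" "minor B k (pick ?K) g = minor B k h g"
    using pick_image[OF h] by (auto intro!: minor_cong)
  then show "0 < minor A k f (pick ?K) * minor B k (pick ?K) g" using assms by simp
  fix K assume "K \<in> {K. K \<subseteq> {..<n} \<and> card K = k}"
  then have "index_seq k n (pick K)" using index_seq_pick[of K n] by auto
  then show "0 \<le> minor A k f (pick K) * minor B k (pick K) g"
    using assms unfolding totally_nonnegative_iff_minor by (intro mult_nonneg_nonneg) auto
qed

lemma totally_nonnegative_pow_Suc:
  assumes A: "A \<in> carrier_mat n n" and tn: "totally_nonnegative A"
  shows "totally_nonnegative (A ^\<^sub>m Suc m)"
proof (induction m)
  case 0
  show ?case using A tn by simp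
next
  case (Suc m)
  show ?case
    using totally_nonnegative_mult[OF pow_carrier_mat[OF A] A Suc tn] by simp
qed

text \<open>A walk of \<open>Suc m\<close> steps between index sequences along positive minors of \<open>A\<close> produces a positive
  minor of the corresponding power. This reduces total positivity of a power to a connectivity
  question about the positive minors of \<open>A\<close>.\<close>
lemma minor_pow_pos_of_chain:
  assumes A: "A \<in> carrier_mat n n" and tn: "totally_nonnegative A" and k: "1 \<le> k"
    and P: "\<And>s. index_seq k n (P s)"
    and step: "\<And>s. s \<le> m \<Longrightarrow> 0 < minor A k (P s) (P (Suc s))"
  shows "0 < minor (A ^\<^sub>m Suc m) k (P 0) (P (Suc m))"
  using step
proof (induction m)
  case 0
  then show ?case using A by simp
next
  case (Suc m)
  have "0 < minor (A ^\<^sub>m Suc m * A) k (P 0) (P (Suc (Suc m)))"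
    by (rule minor_mult_pos[OF pow_carrier_mat[OF A] A totally_nonnegative_pow_Suc[OF A tn] tn k P P P])
       (use Suc in auto)
  then show ?case by simp
qed

section \<open>Minors of the minimum kernel\<close>

text \<open>Subtracting the first column from all others clears the first row except for its first entry \<open>c\<close>.
  The column operations are written as the factor \<open>E\<close> in \<open>M * E\<close>.\<close>
lemma det_constant_first_row:
  fixes F :: "nat \<Rightarrow> nat \<Rightarrow> 'a :: idom"
  assumes row: "\<And>b. b \<le> n \<Longrightarrow> F 0 b = c"
  shows "det (mat (Suc n) (Suc n) (\<lambda>(a, b). F a b))
       = c * det (mat n n (\<lambda>(a, b). F (Suc a) (Suc b) - F (Suc a) 0))"
proof -
  define M where "M = mat (Suc n) (Suc n) (\<lambda>(a, b). if b = 0 then F a 0 else F a b - F a 0)"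
  define E where "E = mat (Suc n) (Suc n) (\<lambda>(a, b). if a = b \<or> a = 0 then 1 else (0 :: 'a))"
  have [simp]: "M \<in> carrier_mat (Suc n) (Suc n)" "E \<in> carrier_mat (Suc n) (Suc n)"
    by (auto simp: M_def E_def)
  have "mat (Suc n) (Suc n) (\<lambda>(a, b). F a b) = M * E"
  proof (rule eq_matI)
    fix a b assume "a < dim_row (M * E)" "b < dim_col (M * E)"
    then have ab: "a < Suc n" "b < Suc n" by (auto simp: M_def E_def)
    have "(M * E) $$ (a, b) = (\<Sum>c<Suc n. M $$ (a, c) * E $$ (c, b))"
      using ab by (auto simp: M_def E_def scalar_prod_def atLeast0LessThan intro!: sum.cong)
    also have "\<dots> = F a 0 + (\<Sum>c<n. if Suc c = b then F a (Suc c) - F a 0 else 0)"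
      using ab by (subst sum.lessThan_Suc_shift) (auto simp: M_def E_def intro!: sum.cong)
    also have "\<dots> = F a b"
      using ab by (cases b) (auto simp: if_distrib cong: if_cong)
    finally show "mat (Suc n) (Suc n) (\<lambda>(a, b). F a b) $$ (a, b) = (M * E) $$ (a, b)"
      using ab by simp
  qed (auto simp: M_def E_def)
  moreover have "det E = 1"
  proof -
    have "det E = prod_list (diag_mat E)"
      by (rule det_upper_triangular[of _ "Suc n"]) (auto simp: E_def)
    also have "\<dots> = 1" unfolding prod_list_diag_prod by (auto simp: E_def intro!: prod.neutral)
    finally show ?thesis .
  qed
  moreover have "det M = c * det (mat n n (\<lambda>(a, b). F (Suc a) (Suc b) - F (Suc a) 0))"
  proof -
    have "det M = (\<Sum>b<Suc n. M $$ (0, b) * cofactor M 0 b)"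
      by (rule laplace_expansion_row) auto
    also have "\<dots> = M $$ (0, 0) * cofactor M 0 0"
      unfolding sum.lessThan_Suc_shift by (auto simp: M_def row intro!: sum.neutral)
    finally have "det M = M $$ (0, 0) * det (mat_delete M 0 0)" by (simp add: cofactor_def)
    moreover have "mat_delete M 0 0 = mat n n (\<lambda>(a, b). F (Suc a) (Suc b) - F (Suc a) 0)"
      by (rule eq_matI) (auto simp: M_def mat_delete_def)
    ultimately show ?thesis by (simp add: M_def row)
  qed
  ultimately show ?thesis by (simp add: det_mult[where n = "Suc n"])
qed

text \<open>The minors of a kernel \<open>f (min i j)\<close>. If \<open>i 0 \<le> j 0\<close>, the first row is constant, equal to
  \<open>f (i 0)\<close>. Clearing it leaves the kernel \<open>f - f (j 0)\<close> on the remaining indices provided that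
  \<open>j 0 < i 1\<close>; otherwise the next row becomes zero as well. The other case is the transposed one.
  The inner minimum merges both possibilities into one formula: it makes the factor \<open>0\<close>
  as soon as \<open>max (i a) (j a)\<close> reaches the next pair of indices.\<close>
lemma det_min_kernel:
  fixes f :: "nat \<Rightarrow> 'a :: idom"
  assumes "mono_on {..k} i" and "mono_on {..k} j"
  shows "det (mat (Suc k) (Suc k) (\<lambda>(a, b). f (min (i a) (j b))))
       = f (min (i 0) (j 0)) * (\<Prod>a<k. f (min (i (Suc a)) (j (Suc a)))
           - f (min (max (i a) (j a)) (min (i (Suc a)) (j (Suc a)))))"
  using assms
proof (induction k arbitrary: i j f)
  case 0
  show ?case by (subst det_single) auto
next
  case (Suc k)
  let ?M = "\<lambda>i j. mat (Suc (Suc k)) (Suc (Suc k)) (\<lambda>(a, b). f (min (i a) (j b)))"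
  let ?F = "\<lambda>f i j a. f (min (i (Suc a)) (j (Suc a)))
           - f (min (max (i a) (j a)) (min (i (Suc a)) (j (Suc a)))) :: 'a"
  have *: "det (?M i j) = f (i 0) * (\<Prod>a<Suc k. ?F f i j a)"
    if mi: "mono_on {..Suc k} i" and mj: "mono_on {..Suc k} j" and le: "i 0 \<le> j 0" for i j
  proof -
    have i0: "i a \<le> i b" and j0: "j a \<le> j b" if "a \<le> b" "b \<le> Suc k" for a b
      using mi mj that by (auto simp: mono_on_def)
    let ?N = "mat (Suc k) (Suc k)
      (\<lambda>(a, b). f (min (i (Suc a)) (j (Suc b))) - f (min (i (Suc a)) (j 0)))"
    have "det (?M i j) = f (i 0) * det ?N"
      by (rule det_constant_first_row) (use le j0[of 0] in \<open>auto simp: min_def dest: order_trans\<close>)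
    also have "det ?N = (\<Prod>a<Suc k. ?F f i j a)"
    proof (cases "i 1 \<le> j 0")
      case True
      have "det ?N = (\<Sum>b<Suc k. ?N $$ (0, b) * cofactor ?N 0 b)"
        by (rule laplace_expansion_row) auto
      also have "\<dots> = 0"
      proof (rule sum.neutral, rule ballI)
        fix b assume "b \<in> {..<Suc k}"
        then have "i 1 \<le> j (Suc b)" using True j0[of 0 "Suc b"] by auto
        then show "?N $$ (0, b) * cofactor ?N 0 b = 0"
          using True \<open>b \<in> _\<close> by (simp add: min_absorb1)
      qed
      finally have "det ?N = 0" .
      moreover have "?F f i j 0 = 0"
        using True le j0[of 0 1] by (auto simp: min_def max_def)
      ultimately show ?thesis
        unfolding prod.lessThan_Suc_shift by simp
    next
      case False
      define g where "g m = f m - f (j 0)" for m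
      have N_eq: "?N = mat (Suc k) (Suc k) (\<lambda>(a, b). g (min (i (Suc a)) (j (Suc b))))"
      proof (rule eq_matI)
        fix a b assume "a < dim_row (mat (Suc k) (Suc k) (\<lambda>(a, b). g (min (i (Suc a)) (j (Suc b)))))"
          "b < dim_col (mat (Suc k) (Suc k) (\<lambda>(a, b). g (min (i (Suc a)) (j (Suc b)))))"
        then show "?N $$ (a, b)
            = mat (Suc k) (Suc k) (\<lambda>(a, b). g (min (i (Suc a)) (j (Suc b)))) $$ (a, b)"
          using False i0[of 1 "Suc a"] by (simp add: g_def min_absorb2)
      qed auto
      have "det ?N = g (min (i 1) (j 1)) * (\<Prod>a<k. ?F g (i \<circ> Suc) (j \<circ> Suc) a)"
        unfolding N_eq using Suc.IH[of "i \<circ> Suc" "j \<circ> Suc" g] i0 j0 by (simp add: mono_on_def)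
      moreover have "g (min (i 1) (j 1)) = ?F f i j 0"
        using False le j0[of 0 1] by (simp add: g_def min_def max_def)
      moreover have "(\<Prod>a<k. ?F g (i \<circ> Suc) (j \<circ> Suc) a) = (\<Prod>a<k. ?F f i j (Suc a))"
        by (simp add: g_def)
      ultimately show ?thesis unfolding prod.lessThan_Suc_shift by (simp only:)
    qed
    finally show ?thesis .
  qed
  show ?case
  proof (cases "i 0 \<le> j 0")
    case True
    then show ?thesis using *[OF Suc.prems] by (simp add: min_absorb1)
  next
    case False
    have "?M i j = transpose_mat (?M j i)" by (rule eq_matI) (auto simp: min.commute)
    then have "det (?M i j) = det (?M j i)"
      by (simp add: det_transpose[where n = "Suc (Suc k)"])
    also have "\<dots> = f (min (i 0) (j 0)) * (\<Prod>a<Suc k. ?F f j i a)"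
      using *[OF Suc.prems(2,1)] False by (simp add: min_absorb2)
    finally show ?thesis by (simp add: min.commute max.commute)
  qed
qed

section \<open>Congruence with a diagonal matrix and inverses\<close>

lemma square_carrier [simp]:
  "A \<in> carrier_mat n n \<Longrightarrow> B \<in> carrier_mat n n \<Longrightarrow> A * B \<in> carrier_mat n n"
  "A \<in> carrier_mat n n \<Longrightarrow> v \<in> carrier_vec n \<Longrightarrow> A *\<^sub>v v \<in> carrier_vec n"
  by auto

lemma quadratic_form_congruent_diag:
  fixes U :: "real mat"
  assumes U: "U \<in> carrier_mat n n" and v: "v \<in> carrier_vec n"
  shows "v \<bullet> ((transpose_mat U * (mat_diag n d * U)) *\<^sub>v v) = (\<Sum>i<n. d i * ((U *\<^sub>v v) $ i)\<^sup>2)"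
proof -
  have Uv: "U *\<^sub>v v \<in> carrier_vec n" using U v by simp
  have DUv: "mat_diag n d *\<^sub>v (U *\<^sub>v v) \<in> carrier_vec n" using Uv by simp
  have ent: "(mat_diag n d *\<^sub>v (U *\<^sub>v v)) $ i = d i * (U *\<^sub>v v) $ i" if "i < n" for i
  proof -
    have "(mat_diag n d *\<^sub>v (U *\<^sub>v v)) $ i = (\<Sum>l = 0..<n. (if i = l then d l else 0) * (U *\<^sub>v v) $ l)"
      using U that by (simp add: mat_diag_def scalar_prod_def)
    also have "\<dots> = (\<Sum>l = 0..<n. if i = l then d l * (U *\<^sub>v v) $ l else 0)"
      by (rule sum.cong) auto
    finally show ?thesis using that by simp
  qed
  have "(transpose_mat U * (mat_diag n d * U)) *\<^sub>v v
      = transpose_mat U *\<^sub>v (mat_diag n d *\<^sub>v (U *\<^sub>v v))"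
    using U v by (simp add: assoc_mult_mat_vec[where n\<^sub>1 = n and n\<^sub>2 = n and n\<^sub>3 = n])
  then have "v \<bullet> ((transpose_mat U * (mat_diag n d * U)) *\<^sub>v v)
      = (transpose_mat U *\<^sub>v (mat_diag n d *\<^sub>v (U *\<^sub>v v))) \<bullet> v"
    using U v DUv by (simp add: comm_scalar_prod[where n = n])
  also have "\<dots> = (mat_diag n d *\<^sub>v (U *\<^sub>v v)) \<bullet> (U *\<^sub>v v)"
    by (rule transpose_vec_mult_scalar[OF U v DUv])
  also have "\<dots> = (\<Sum>i<n. d i * ((U *\<^sub>v v) $ i)\<^sup>2)"
    using U by (auto simp: scalar_prod_def ent power2_eq_square atLeast0LessThan intro!: sum.cong)
  finally show ?thesis .
qed

text \<open>The quadratic form is the sum of \<open>d i\<close> times the squared \<open>i\<close>-th coordinate of \<open>U v\<close>, and \<open>U v\<close>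
  ranges over all vectors; the columns of \<open>W\<close> isolate the single coefficients.\<close>
lemma positive_definite_congruent_diag:
  fixes U :: "real mat"
  assumes U: "U \<in> carrier_mat n n" and W: "W \<in> carrier_mat n n"
    and UW: "U * W = 1\<^sub>m n" and WU: "W * U = 1\<^sub>m n"
  shows "positive_definite (transpose_mat U * (mat_diag n d * U)) \<longleftrightarrow> (\<forall>i<n. 0 < d i)"
    (is "positive_definite ?A \<longleftrightarrow> _")
proof
  note q = quadratic_form_congruent_diag[OF U]
  have A: "?A \<in> carrier_mat n n" using U by simp
  have zero: "M *\<^sub>v 0\<^sub>v n = 0\<^sub>v n" if "M \<in> carrier_mat n n" for M :: "real mat"
    using that by (intro eq_vecI) auto
  {
    assume pd: "positive_definite ?A"
    show "\<forall>i<n. 0 < d i"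
    proof (intro allI impI)
      fix i assume i: "i < n"
      \<comment> \<open>\<open>U\<close> maps this vector to the unit vector, so the form takes the value \<open>d i\<close> there.\<close>
      let ?v = "W *\<^sub>v unit_vec n i"
      have v: "?v \<in> carrier_vec n" using W by simp
      have Uv: "U *\<^sub>v ?v = unit_vec n i"
        using assoc_mult_mat_vec[OF U W, of "unit_vec n i"] UW by simp
      have "?v \<noteq> 0\<^sub>v n"
      proof
        assume "?v = 0\<^sub>v n"
        then have "unit_vec n i = (0\<^sub>v n :: real vec)" using Uv zero[OF U] by simp
        then have "unit_vec n i $ i = (0\<^sub>v n :: real vec) $ i" by simp
        then show False using i by simp
      qed
      then have "0 < ?v \<bullet> (?A *\<^sub>v ?v)" using pd v A U unfolding positive_definite_def by auto
      also have "\<dots> = (\<Sum>l<n. if l = i then d l else 0)"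
        unfolding q[OF v] Uv by (rule sum.cong) (use i in auto)
      finally show "0 < d i" using i by simp
    qed
  }
  assume d: "\<forall>i<n. 0 < d i"
  have "transpose_mat (mat_diag n d) = mat_diag n d" by (rule eq_matI) (auto simp: mat_diag_def)
  then have sym: "transpose_mat ?A = ?A"
    using U by (simp add: transpose_mult[where n = n and nr = n and nc = n]
        assoc_mult_mat[where n\<^sub>1 = n and n\<^sub>2 = n and n\<^sub>3 = n and n\<^sub>4 = n])
  have "0 < v \<bullet> (?A *\<^sub>v v)" if v: "v \<in> carrier_vec n" "v \<noteq> 0\<^sub>v n" for v
  proof -
    have "\<exists>i<n. (U *\<^sub>v v) $ i \<noteq> 0"
    proof (rule ccontr)
      assume "\<not> ?thesis"
      then have "U *\<^sub>v v = 0\<^sub>v n" using U by (intro eq_vecI) auto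
      moreover have "v = W *\<^sub>v (U *\<^sub>v v)"
        using assoc_mult_mat_vec[OF W U v(1)] WU v(1) by simp
      ultimately show False using zero[OF W] v by simp
    qed
    then obtain i where "i < n" "(U *\<^sub>v v) $ i \<noteq> 0" by blast
    then show ?thesis unfolding q[OF v(1)] using d
      by (intro sum_pos2[of _ i]) (auto simp: less_imp_le)
  qed
  then show "positive_definite ?A"
    using A sym U unfolding positive_definite_def by auto
qed

lemma invertible_iff_det:
  fixes A :: "real mat"
  assumes A: "A \<in> carrier_mat n n"
  shows "invertible_mat A \<longleftrightarrow> det A \<noteq> 0"
proof
  assume "invertible_mat A"
  then obtain B where B: "A * B = 1\<^sub>m n" "B * A = 1\<^sub>m (dim_row B)"
    using A unfolding invertible_mat_def inverts_mat_def by auto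
  have "dim_col B = n" using arg_cong[OF B(1), of dim_col] by simp
  moreover have "dim_row B = n" using arg_cong[OF B(2), of dim_col] A by simp
  ultimately have "B \<in> carrier_mat n n" by auto
  from det_mult[OF A this] B(1) show "det A \<noteq> 0" by auto
next
  assume "det A \<noteq> 0"
  from det_non_zero_imp_unit[OF A this, of undefined]
  obtain B where "B \<in> carrier_mat n n" "A * B = 1\<^sub>m n" "B * A = 1\<^sub>m n"
    unfolding Units_def ring_mat_def by auto
  then show "invertible_mat A"
    using A unfolding invertible_mat_def inverts_mat_def by auto
qed

text \<open>The inverse of the inverse of \<open>A\<close> is \<open>A\<close>, so the nonnegativity that the definition of an
  M-matrix asks of the inverse of \<open>B\<close> is nonnegativity of \<open>A\<close>.\<close>
lemma nonsingular_inverse_M_matrix_iff: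
  assumes A: "A \<in> carrier_mat n n"
  shows "nonsingular_inverse_M_matrix A \<longleftrightarrow> entrywise_nonnegative A \<and>
    (\<exists>B \<in> carrier_mat n n. A * B = 1\<^sub>m n \<and> B * A = 1\<^sub>m n \<and> Z_matrix B)"
proof
  assume "nonsingular_inverse_M_matrix A"
  then obtain B C where B: "A * B = 1\<^sub>m n" "B * A = 1\<^sub>m (dim_row B)" and Z: "Z_matrix B"
    and C: "B * C = 1\<^sub>m (dim_row B)" "C * B = 1\<^sub>m (dim_row C)" and nonneg: "entrywise_nonnegative C"
    using A unfolding nonsingular_inverse_M_matrix_def nonsingular_M_matrix_def inverts_mat_def
    by auto
  have "dim_col B = n" using arg_cong[OF B(1), of dim_col] by simp
  moreover have rB: "dim_row B = n" using arg_cong[OF B(2), of dim_col] A by simp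
  ultimately have Bc: "B \<in> carrier_mat n n" by auto
  have "dim_col C = n" using arg_cong[OF C(1), of dim_col] rB by simp
  moreover have "dim_row C = n" using arg_cong[OF C(2), of dim_col] Bc by simp
  ultimately have Cc: "C \<in> carrier_mat n n" by auto
  have "C = (A * B) * C" using B Cc by simp
  also have "\<dots> = A * (B * C)" by (rule assoc_mult_mat[OF A Bc Cc])
  also have "\<dots> = A" using C rB A by simp
  finally show "entrywise_nonnegative A \<and>
    (\<exists>B \<in> carrier_mat n n. A * B = 1\<^sub>m n \<and> B * A = 1\<^sub>m n \<and> Z_matrix B)"
    using nonneg B Bc rB Z by auto
next
  assume "entrywise_nonnegative A \<and>
    (\<exists>B \<in> carrier_mat n n. A * B = 1\<^sub>m n \<and> B * A = 1\<^sub>m n \<and> Z_matrix B)"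
  then show "nonsingular_inverse_M_matrix A"
    using A unfolding nonsingular_inverse_M_matrix_def nonsingular_M_matrix_def inverts_mat_def
    by auto
qed

section \<open>The triangular factorization of the Min matrix\<close>

definition increment :: "real vec \<Rightarrow> nat \<Rightarrow> real" where
  "increment x i = (if i = 0 then x $ 0 else x $ i - x $ (i - 1))"

definition upper_ones :: "nat \<Rightarrow> real mat" where
  "upper_ones n = mat n n (\<lambda>(i, j). if i \<le> j then 1 else 0)"

definition upper_difference :: "nat \<Rightarrow> real mat" where
  "upper_difference n = mat n n (\<lambda>(i, j). if i = j then 1 else if Suc i = j then -1 else 0)"

lemma upper_carrier [simp]:
  "upper_ones n \<in> carrier_mat n n" "upper_difference n \<in> carrier_mat n n"
  "dim_row (upper_ones n) = n" "dim_col (upper_ones n) = n"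
  "dim_row (upper_difference n) = n" "dim_col (upper_difference n) = n"
  by (auto simp: upper_ones_def upper_difference_def)

lemma upper_ones_mult_difference: "upper_ones n * upper_difference n = 1\<^sub>m n"
proof (rule eq_matI)
  fix i j assume "i < dim_row (1\<^sub>m n :: real mat)" "j < dim_col (1\<^sub>m n :: real mat)"
  then have ij: "i < n" "j < n" by auto
  have "(upper_ones n * upper_difference n) $$ (i, j)
      = (\<Sum>l<n. (if i \<le> l then 1 else 0) * (if l = j then 1 else if Suc l = j then -1 else 0))"
    using ij by (auto simp: upper_ones_def upper_difference_def scalar_prod_def atLeast0LessThan
        intro!: sum.cong)
  also have "\<dots> = (\<Sum>l<n. (if l = j then if i \<le> l then 1 else 0 else 0)
        - (if Suc l = j then if i \<le> l then 1 else 0 else 0))"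
    by (rule sum.cong) auto
  also have "\<dots> = (if i = j then 1 else 0)"
    unfolding sum_subtractf using ij by (cases j) auto
  finally show "(upper_ones n * upper_difference n) $$ (i, j) = 1\<^sub>m n $$ (i, j)"
    using ij by simp
qed auto

lemma upper_difference_mult_ones: "upper_difference n * upper_ones n = 1\<^sub>m n"
  by (rule mat_mult_left_right_inverse[OF _ _ upper_ones_mult_difference]) auto

lemma min_matrix_carrier [simp]:
  "x \<in> carrier_vec n \<Longrightarrow> min_matrix x \<in> carrier_mat n n"
  by (auto simp: min_matrix_def)

lemma sum_increment: "(\<Sum>l\<le>m. increment x l) = x $ m"
  by (induction m) (auto simp: increment_def)

text \<open>Since \<open>x\<^sub>m\<close> is the sum of the increments up to \<open>m\<close>, the entry at \<open>(i, j)\<close> sums the increments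
  with index at most \<open>i\<close> and at most \<open>j\<close>.\<close>
lemma min_matrix_factorization:
  assumes x: "x \<in> carrier_vec n"
  shows "min_matrix x
    = transpose_mat (upper_ones n) * (mat_diag n (increment x) * upper_ones n)" (is "_ = ?R")
proof (rule eq_matI)
  fix i j assume "i < dim_row ?R" "j < dim_col ?R"
  then have ij: "i < n" "j < n" by (auto simp: mat_diag_def)
  have "?R $$ (i, j) = (\<Sum>l<n. (if l \<le> i then 1 else 0) * (increment x l * (if l \<le> j then 1 else 0)))"
    using ij by (auto simp: mat_diag_mult_left[of _ n n] scalar_prod_def upper_ones_def
        atLeast0LessThan intro!: sum.cong)
  also have "\<dots> = (\<Sum>l\<le>min i j. increment x l)"
    using ij by (intro sum.mono_neutral_cong_right) auto
  also have "\<dots> = x $ min i j" by (rule sum_increment)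
  finally show "min_matrix x $$ (i, j) = ?R $$ (i, j)" using ij x by (simp add: min_matrix_def)
qed (use x in \<open>auto simp: min_matrix_def mat_diag_def\<close>)

lemma det_mat_diag: "det (mat_diag n d) = (\<Prod>i<n. d i)"
proof -
  have "det (mat_diag n d) = prod_list (diag_mat (mat_diag n d))"
    by (rule det_upper_triangular[of _ n]) (auto simp: mat_diag_def)
  also have "\<dots> = (\<Prod>i<n. d i)" unfolding prod_list_diag_prod
    by (auto simp: mat_diag_def atLeast0LessThan intro!: prod.cong)
  finally show ?thesis .
qed

lemma det_min_matrix:
  assumes x: "x \<in> carrier_vec n"
  shows "det (min_matrix x) = (\<Prod>i<n. increment x i)"
proof -
  have "det (upper_ones n) = prod_list (diag_mat (upper_ones n))"
    by (rule det_upper_triangular[of _ n]) (auto simp: upper_ones_def)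
  also have "\<dots> = 1" unfolding prod_list_diag_prod
    by (auto simp: upper_ones_def intro!: prod.neutral)
  finally show ?thesis unfolding min_matrix_factorization[OF x]
    by (simp add: det_mult[where n = n] det_transpose[where n = n] det_mat_diag)
qed

lemma min_matrix_inverse:
  assumes x: "x \<in> carrier_vec n" and d: "\<forall>i<n. increment x i \<noteq> 0"
  defines "B \<equiv> upper_difference n *
    (mat_diag n (\<lambda>i. 1 / increment x i) * transpose_mat (upper_difference n))"
  shows "B \<in> carrier_mat n n" and "min_matrix x * B = 1\<^sub>m n" and "B * min_matrix x = 1\<^sub>m n"
proof -
  let ?U = "upper_ones n" and ?W = "upper_difference n"
  let ?D = "mat_diag n (increment x)" and ?E = "mat_diag n (\<lambda>i. 1 / increment x i)"
  show B: "B \<in> carrier_mat n n" by (simp add: B_def)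
  note assoc = assoc_mult_mat[where n\<^sub>1 = n and n\<^sub>2 = n and n\<^sub>3 = n and n\<^sub>4 = n]
  have DE: "?D * ?E = 1\<^sub>m n" unfolding mat_diag_diag
    by (rule eq_matI) (use d in \<open>auto simp: mat_diag_def\<close>)
  have TT: "transpose_mat ?U * transpose_mat ?W = 1\<^sub>m n"
    using transpose_mult[of ?W n n ?U n] upper_difference_mult_ones[of n] by simp
  have "min_matrix x * B = transpose_mat ?U * (?D * ((?U * ?W) * (?E * transpose_mat ?W)))"
    unfolding min_matrix_factorization[OF x] B_def by (simp add: assoc)
  also have "\<dots> = transpose_mat ?U * ((?D * ?E) * transpose_mat ?W)"
    by (simp add: upper_ones_mult_difference assoc left_mult_one_mat[where nr = n and nc = n]
        del: mat_diag_diag)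
  also have "\<dots> = 1\<^sub>m n" by (simp add: DE TT del: mat_diag_diag)
  finally show AB: "min_matrix x * B = 1\<^sub>m n" .
  show "B * min_matrix x = 1\<^sub>m n"
    by (rule mat_mult_left_right_inverse[OF _ B AB]) (use x in simp)
qed

lemma difference_congruence_entry:
  assumes ij: "i < n" "j < n"
  shows "(upper_difference n *
      (mat_diag n e * transpose_mat (upper_difference n))) $$ (i, j)
    = (\<Sum>l<n. upper_difference n $$ (i, l) * (e l * upper_difference n $$ (j, l)))"
  using ij by (auto simp: mat_diag_mult_left[of _ n n] scalar_prod_def
        atLeast0LessThan intro!: sum.cong)

lemma increasing_iff_increment_pos:
  assumes "1 \<le> n"
  shows "(0 < x $ 0 \<and> (\<forall>i. Suc i < n \<longrightarrow> x $ i < x $ Suc i)) \<longleftrightarrow> (\<forall>i<n. 0 < increment x i)"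
proof
  assume *: "0 < x $ 0 \<and> (\<forall>i. Suc i < n \<longrightarrow> x $ i < x $ Suc i)"
  show "\<forall>i<n. 0 < increment x i"
  proof (intro allI impI)
    fix i assume "i < n" then show "0 < increment x i"
      using * by (cases i) (auto simp: increment_def)
  qed
next
  assume *: "\<forall>i<n. 0 < increment x i"
  have "x $ i < x $ Suc i" if "Suc i < n" for i
    using *[rule_format, OF that] by (simp add: increment_def)
  moreover have "0 < x $ 0" using * assms by (auto simp: increment_def dest: spec[of _ 0])
  ultimately show "0 < x $ 0 \<and> (\<forall>i. Suc i < n \<longrightarrow> x $ i < x $ Suc i)" by blast
qed

lemma increment_pos_imp_strict_mono:
  assumes "\<forall>i<n. 0 < increment x i" and "i < j" and "j < n"
  shows "x $ i < x $ j"
proof -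
  have "x $ j - x $ i = (\<Sum>l\<in>{Suc i..j}. increment x l)"
  proof -
    have "{..j} = {..i} \<union> {Suc i..j}" using assms by auto
    then have "(\<Sum>l\<le>j. increment x l) = (\<Sum>l\<le>i. increment x l) + (\<Sum>l\<in>{Suc i..j}. increment x l)"
      by (simp add: sum.union_disjoint)
    then show ?thesis by (simp add: sum_increment)
  qed
  also have "\<dots> > 0" by (rule sum_pos) (use assms in auto)
  finally show ?thesis by simp
qed

lemma increment_pos_imp_pos:
  assumes "\<forall>i<n. 0 < increment x i" and "i < n"
  shows "0 < x $ i"
proof -
  have "x $ i = (\<Sum>l\<le>i. increment x l)" by (simp add: sum_increment)
  also have "\<dots> > 0" by (rule sum_pos) (use assms in auto)
  finally show ?thesis .
qed

lemma min_matrix_positive_definite_iff: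
  assumes x: "x \<in> carrier_vec n"
  shows "positive_definite (min_matrix x) \<longleftrightarrow> (\<forall>i<n. 0 < increment x i)"
  unfolding min_matrix_factorization[OF x]
  by (rule positive_definite_congruent_diag)
     (rule upper_carrier upper_ones_mult_difference upper_difference_mult_ones)+

lemma min_matrix_invertible_iff:
  assumes x: "x \<in> carrier_vec n"
  shows "invertible_mat (min_matrix x) \<longleftrightarrow> (\<forall>i<n. increment x i \<noteq> 0)"
  using invertible_iff_det[of "min_matrix x" n] det_min_matrix[OF x] x by auto

text \<open>The inverse of the Min matrix is tridiagonal with entry \<open>- 1 / d\<close> next to the diagonal, where
  \<open>d\<close> is an increment of positive index, so its sign pattern decides the sign of all increments but
  the first. The first one is the corner entry of the Min matrix itself.\<close>
lemma min_matrix_inverse_M_iff: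
  assumes n: "1 \<le> n" and x: "x \<in> carrier_vec n"
  shows "nonsingular_inverse_M_matrix (min_matrix x) \<longleftrightarrow> (\<forall>i<n. 0 < increment x i)"
proof
  let ?A = "min_matrix x"
  let ?B = "upper_difference n * (mat_diag n (\<lambda>i. 1 / increment x i) * transpose_mat (upper_difference n))"
  have A: "?A \<in> carrier_mat n n" using x by simp
  {
    assume "nonsingular_inverse_M_matrix ?A"
    then obtain B where nonneg: "entrywise_nonnegative ?A" and B: "B \<in> carrier_mat n n"
      and AB: "?A * B = 1\<^sub>m n" "B * ?A = 1\<^sub>m n" and Z: "Z_matrix B"
      unfolding nonsingular_inverse_M_matrix_iff[OF A] by blast
    have "invertible_mat ?A"
      using A B AB unfolding invertible_mat_def inverts_mat_def by auto
    then have d: "\<forall>i<n. increment x i \<noteq> 0" using min_matrix_invertible_iff[OF x] by blast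
    have "B = B * (?A * ?B)" using min_matrix_inverse[OF x d] B by simp
    also have "\<dots> = (B * ?A) * ?B" using min_matrix_inverse(1)[OF x d] A B
      by (simp add: assoc_mult_mat[where n\<^sub>1 = n and n\<^sub>2 = n and n\<^sub>3 = n and n\<^sub>4 = n])
    also have "\<dots> = ?B" unfolding AB using min_matrix_inverse(1)[OF x d] by (rule left_mult_one_mat)
    finally have BB: "B = ?B" .
    show "\<forall>i<n. 0 < increment x i"
    proof (intro allI impI)
      fix i assume i: "i < n"
      show "0 < increment x i"
      proof (cases i)
        case 0
        have "0 \<le> ?A $$ (0, 0)" using nonneg A n unfolding entrywise_nonnegative_def by auto
        then have "0 \<le> increment x 0" using n x by (simp add: min_matrix_def increment_def)
        then show ?thesis using d i 0 by (metis order_le_less)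
      next
        case (Suc m)
        then have m: "m < n" "Suc m < n" using i by auto
        have "B $$ (m, Suc m) = (\<Sum>l<n. upper_difference n $$ (m, l)
            * (1 / increment x l * upper_difference n $$ (Suc m, l)))"
          unfolding BB by (rule difference_congruence_entry[OF m])
        also have "\<dots> = (\<Sum>l<n. if l = Suc m then - 1 / increment x l else 0)"
          by (rule sum.cong) (use m in \<open>auto simp: upper_difference_def\<close>)
        also have "\<dots> = - 1 / increment x i" using i Suc by simp
        finally have "- 1 / increment x i \<le> 0"
          using Z B m Suc unfolding Z_matrix_def by (metis carrier_matD n_not_Suc_n)
        then show ?thesis using d[rule_format, OF i] by (simp add: zero_le_divide_1_iff)
      qed
    qed
  }
  assume pos: "\<forall>i<n. 0 < increment x i"
  then have d: "\<forall>i<n. increment x i \<noteq> 0" by auto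
  note inv = min_matrix_inverse[OF x d]
  have "Z_matrix ?B"
    unfolding Z_matrix_def
  proof (intro conjI allI impI)
    show "square_mat ?B" using inv(1) by auto
    fix i j assume "i < dim_row ?B" "j < dim_col ?B" and ne: "i \<noteq> j"
    then have ij: "i < n" "j < n" by auto
    show "?B $$ (i, j) \<le> 0"
      unfolding difference_congruence_entry[OF ij]
    proof (rule sum_nonpos)
      fix l assume "l \<in> {..<n}"
      then show "upper_difference n $$ (i, l) * (1 / increment x l * upper_difference n $$ (j, l)) \<le> 0"
        using pos ne ij by (auto simp: upper_difference_def less_imp_le)
    qed
  qed
  moreover have "entrywise_nonnegative ?A"
    unfolding entrywise_nonnegative_def
    using increment_pos_imp_pos[OF pos] x by (auto simp: min_matrix_def less_imp_le)
  ultimately show "nonsingular_inverse_M_matrix ?A"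
    unfolding nonsingular_inverse_M_matrix_iff[OF A] using inv by blast
qed

section \<open>Total nonnegativity and oscillation of the Min matrix\<close>

lemma minor_min_matrix:
  assumes x: "x \<in> carrier_vec n" and f: "index_seq (Suc k) n f" and g: "index_seq (Suc k) n g"
  shows "minor (min_matrix x) (Suc k) f g = x $ min (f 0) (g 0) *
    (\<Prod>a<k. x $ min (f (Suc a)) (g (Suc a))
      - x $ min (max (f a) (g a)) (min (f (Suc a)) (g (Suc a))))"
proof -
  have mono: "mono_on {..k} h" if "index_seq (Suc k) n h" for h
    using index_seqD(2)[OF that] by (auto simp: mono_on_def le_less)
  have "mat (Suc k) (Suc k) (\<lambda>(a, b). min_matrix x $$ (f a, g b))
      = mat (Suc k) (Suc k) (\<lambda>(a, b). x $ min (f a) (g b))"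
    by (rule eq_matI) (use x index_seqD[OF f] index_seqD[OF g] in \<open>auto simp: min_matrix_def\<close>)
  then show ?thesis unfolding minor_def
    by (simp only: det_min_kernel[OF mono[OF f] mono[OF g]])
qed

lemma min_matrix_totally_nonnegative:
  assumes x: "x \<in> carrier_vec n" and pos: "\<forall>i<n. 0 < increment x i"
  shows "totally_nonnegative (min_matrix x)"
  unfolding totally_nonnegative_iff_minor
proof (intro allI impI)
  fix k f g assume "1 \<le> k" "index_seq k (dim_row (min_matrix x)) f"
    "index_seq k (dim_col (min_matrix x)) g"
  then obtain k' where k: "k = Suc k'" and f: "index_seq (Suc k') n f" and g: "index_seq (Suc k') n g"
    using x by (cases k) (auto simp: min_matrix_def)
  have mono: "x $ i \<le> x $ j" if "i \<le> j" "j < n" for i j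
    using increment_pos_imp_strict_mono[OF pos, of i j] that by (auto simp: le_less)
  show "0 \<le> minor (min_matrix x) k f g"
    unfolding k minor_min_matrix[OF x f g]
  proof (intro mult_nonneg_nonneg prod_nonneg)
    have "min (f 0) (g 0) < n" using index_seqD(1)[OF f, of 0] by auto
    then show "0 \<le> x $ min (f 0) (g 0)"
      by (intro less_imp_le increment_pos_imp_pos[OF pos])
    fix a assume "a \<in> {..<k'}"
    then have "min (f (Suc a)) (g (Suc a)) < n" using index_seqD(1)[OF f, of "Suc a"] by auto
    then show "0 \<le> x $ min (f (Suc a)) (g (Suc a))
      - x $ min (max (f a) (g a)) (min (f (Suc a)) (g (Suc a)))"
      unfolding diff_ge_0_iff_ge by (intro mono min.cobounded2)
  qed
qed

text \<open>Of the products in the minor formula, only those with strictly interlacing index pairs survive;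
  each is an entry of a positive vector times differences of entries at strictly
  increasing positions.\<close>
lemma minor_min_matrix_pos:
  assumes x: "x \<in> carrier_vec n" and pos: "\<forall>i<n. 0 < increment x i"
    and f: "index_seq k n f" and g: "index_seq k n g" and k: "1 \<le> k"
    and inter: "\<And>a. Suc a < k \<Longrightarrow> max (f a) (g a) < min (f (Suc a)) (g (Suc a))"
  shows "0 < minor (min_matrix x) k f g"
proof -
  obtain k' where k': "k = Suc k'" using k by (cases k) auto
  show ?thesis
    unfolding k' minor_min_matrix[OF x f[unfolded k'] g[unfolded k']]
  proof (intro mult_pos_pos prod_pos)
    have "min (f 0) (g 0) < n" using index_seqD(1)[OF f, of 0] k by auto
    then show "0 < x $ min (f 0) (g 0)" by (rule increment_pos_imp_pos[OF pos])
    fix a assume a: "a \<in> {..<k'}"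
    then have "min (f (Suc a)) (g (Suc a)) < n" using index_seqD(1)[OF f, of "Suc a"] k' by auto
    then show "0 < x $ min (f (Suc a)) (g (Suc a))
      - x $ min (max (f a) (g a)) (min (f (Suc a)) (g (Suc a)))"
      using increment_pos_imp_strict_mono[OF pos] inter[of a] a k'
      by (simp add: min_absorb1 less_imp_le)
  qed
qed

lemma index_seq_ge:
  assumes "index_seq k n f" and "a < k"
  shows "a \<le> f a"
  using assms(2)
proof (induction a)
  case (Suc a)
  then show ?case using index_seqD(2)[OF assms(1), of a "Suc a"] by simp
qed simp

text \<open>The intermediate stations between an index sequence \<open>f\<close> and the initial segment
  \<open>0, 1, 2, \<dots>\<close>: the leading entries are moved down to their least possible values one at a
  time.\<close>
definition fill :: "(nat \<Rightarrow> nat) \<Rightarrow> nat \<Rightarrow> nat \<Rightarrow> nat" where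
  "fill f t a = (if a < t then a else f a)"

lemma index_seq_fill:
  assumes f: "index_seq k n f"
  shows "index_seq k n (fill f t)"
proof (rule index_seqI)
  fix a assume "a < k"
  then show "fill f t a < n"
    using index_seq_ge[OF f] index_seqD(1)[OF f] by (auto simp: fill_def intro: le_less_trans)
next
  fix a b assume ab: "a < b" "b < k"
  then show "fill f t a < fill f t b"
    using index_seqD(2)[OF f ab] index_seq_ge[OF f ab(2)] by (auto simp: fill_def)
qed

text \<open>Moving a single entry into the free place just above its predecessor never crosses another
  entry, so two consecutive stations satisfy the positivity condition for minors.\<close>
lemma fill_interlace:
  assumes f: "index_seq k n f" and a: "Suc a < k"
  shows "max (fill f t a) (fill f (Suc t) a) < min (fill f t (Suc a)) (fill f (Suc t) (Suc a))"
  using index_seqD(2)[OF f lessI a] index_seq_ge[OF f, of a] index_seq_ge[OF f a] a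
  by (auto simp: fill_def)

text \<open>From \<open>f\<close> it takes at most \<open>n\<close> steps down to the initial segment, and from there at most \<open>n\<close>
  steps up to \<open>g\<close>. Idle steps are harmless because principal minors are positive, so the
  same length \<open>2 * n\<close> serves all pairs.\<close>
lemma min_matrix_pow_minor_pos:
  assumes n: "1 \<le> n" and x: "x \<in> carrier_vec n" and pos: "\<forall>i<n. 0 < increment x i"
    and k: "1 \<le> k" and f: "index_seq k n f" and g: "index_seq k n g"
  shows "0 < minor (min_matrix x ^\<^sub>m (2 * n)) k f g"
proof -
  define P where "P s = (if s < n then fill f s else fill g (2 * n - s))" for s
  have P: "index_seq k n (P s)" for s
    using index_seq_fill[OF f] index_seq_fill[OF g] by (simp add: P_def)
  have kn: "a < n" if "a < k" for a
    using index_seq_ge[OF f that] index_seqD(1)[OF f that] by simp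
  \<comment> \<open>At \<open>s = n\<close> the descent and the ascent meet, as all entries have been filled.\<close>
  then have top: "P n a = fill f n a" if "a < k" for a
    using that by (simp add: P_def fill_def)
  have step: "0 < minor (min_matrix x) k (P s) (P (Suc s))" if s: "s < 2 * n" for s
  proof (rule minor_min_matrix_pos[OF x pos P P k])
    fix a assume a: "Suc a < k"
    show "max (P s a) (P (Suc s) a) < min (P s (Suc a)) (P (Suc s) (Suc a))"
    proof (cases "s < n")
      case True
      have "P (Suc s) b = fill f (Suc s) b" if "b < k" for b
        using True top[OF that] by (cases "Suc s = n") (auto simp: P_def)
      then show ?thesis using fill_interlace[OF f a, of s] True a by (simp add: P_def)
    next
      case False
      have "2 * n - s = Suc (2 * n - Suc s)" using s by simp
      then show ?thesis using fill_interlace[OF g a, of "2 * n - Suc s"] False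
        by (simp add: P_def max.commute min.commute)
    qed
  qed
  obtain m where m: "2 * n = Suc m" using n by (cases "2 * n") auto
  have "0 < minor (min_matrix x ^\<^sub>m Suc m) k (P 0) (P (Suc m))"
    by (rule minor_pow_pos_of_chain[where P = P and n = n, OF _ min_matrix_totally_nonnegative[OF x pos] k P])
       (use x m step in simp_all)
  moreover have "P 0 = f" "P (2 * n) = g" using n by (auto simp: P_def fill_def fun_eq_iff)
  ultimately show ?thesis unfolding m by simp
qed

lemma min_matrix_oscillatory:
  assumes n: "1 \<le> n" and x: "x \<in> carrier_vec n" and pos: "\<forall>i<n. 0 < increment x i"
  shows "oscillatory (min_matrix x)"
proof -
  have A: "min_matrix x \<in> carrier_mat n n" using x by simp
  then have "dim_row (min_matrix x ^\<^sub>m (2 * n)) = n" "dim_col (min_matrix x ^\<^sub>m (2 * n)) = n"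
    by simp_all
  then have "totally_positive (min_matrix x ^\<^sub>m (2 * n))"
    unfolding totally_positive_iff_minor using min_matrix_pow_minor_pos[OF n x pos] by auto
  then show ?thesis
    unfolding oscillatory_def using min_matrix_totally_nonnegative[OF x pos] A n
    by (auto intro!: exI[of _ "2 * n"])
qed

lemma det_pow_mat:
  assumes A: "(A :: 'a :: comm_ring_1 mat) \<in> carrier_mat n n"
  shows "det (A ^\<^sub>m m) = det A ^ m"
proof (induction m)
  case (Suc m)
  then show ?case using det_mult[OF pow_carrier_mat[OF A] A] by (simp add: mult.commute)
qed (use A in simp)

lemma oscillatory_imp_invertible:
  assumes A: "A \<in> carrier_mat n n" and n: "1 \<le> n" and osc: "oscillatory A"
  shows "invertible_mat A"
proof -
  obtain m where m: "0 < m" "totally_positive (A ^\<^sub>m m)" using osc unfolding oscillatory_def by blast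
  have "index_seq n n id" by (rule index_seqI) auto
  then have "0 < minor (A ^\<^sub>m m) n id id"
    using m(2) n A unfolding totally_positive_iff_minor by simp
  then have "0 < det A ^ m"
    unfolding minor_full[OF pow_carrier_mat[OF A]] det_pow_mat[OF A] .
  then have "det A \<noteq> 0" using m(1) by (auto simp: power_0_left)
  then show ?thesis using invertible_iff_det[OF A] by blast
qed

text \<open>The minor on rows and columns \<open>i, i + 1\<close> equals \<open>x\<^sub>i (x\<^sub>i\<^sub>+\<^sub>1 - x\<^sub>i)\<close>. Its sign, together with
  \<open>x\<^sub>i > 0\<close>, rules out a negative increment, and invertibility rules out a zero one.\<close>
lemma min_matrix_invertible_totally_nonnegative_imp:
  assumes n: "1 \<le> n" and x: "x \<in> carrier_vec n" and inv: "invertible_mat (min_matrix x)"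
    and tn: "totally_nonnegative (min_matrix x)"
  shows "\<forall>i<n. 0 < increment x i"
proof -
  have ne: "increment x i \<noteq> 0" if "i < n" for i
    using inv that min_matrix_invertible_iff[OF x] by blast
  have nonneg: "0 \<le> minor (min_matrix x) k f f" if "1 \<le> k" "index_seq k n f" for k f
    using tn x that unfolding totally_nonnegative_iff_minor by (simp add: min_matrix_def)
  have "0 < increment x i \<and> 0 < x $ i" if "i < n" for i
    using that
  proof (induction i)
    case 0
    have "index_seq (Suc 0) n (\<lambda>_. 0)" by (rule index_seqI) (use n in auto)
    from nonneg[OF _ this] minor_min_matrix[OF x this this] have "0 \<le> x $ 0" by simp
    then show ?case using ne[OF 0] by (simp add: increment_def)
  next
    case (Suc i)
    have s: "index_seq (Suc (Suc 0)) n (\<lambda>a. i + a)" by (rule index_seqI) (use Suc.prems in auto)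
    from nonneg[OF _ s] minor_min_matrix[OF x s s]
    have "0 \<le> x $ i * (x $ Suc i - x $ i)" by simp
    moreover have "0 < x $ i" using Suc by simp
    ultimately have "0 \<le> x $ Suc i - x $ i" by (simp add: zero_le_mult_iff)
    then show ?case using ne[OF Suc.prems] \<open>0 < x $ i\<close> by (simp add: increment_def)
  qed
  then show ?thesis by blast
qed

lemma min_matrix_characterization:
  assumes n: "1 \<le> n" and x: "x \<in> carrier_vec n"
  defines "P \<equiv> 0 < x $ 0 \<and> (\<forall>i. Suc i < n \<longrightarrow> x $ i < x $ Suc i)"
  shows "P \<longleftrightarrow> positive_definite (min_matrix x)"
    and "P \<longleftrightarrow> invertible_mat (min_matrix x) \<and> totally_nonnegative (min_matrix x)"
    and "P \<longleftrightarrow> nonsingular_inverse_M_matrix (min_matrix x)"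
    and "P \<longleftrightarrow> oscillatory (min_matrix x)"
proof -
  have P: "P \<longleftrightarrow> (\<forall>i<n. 0 < increment x i)"
    unfolding P_def by (rule increasing_iff_increment_pos[OF n])
  have A: "min_matrix x \<in> carrier_mat n n" using x by simp
  show "P \<longleftrightarrow> positive_definite (min_matrix x)"
    using P min_matrix_positive_definite_iff[OF x] by simp
  show "P \<longleftrightarrow> nonsingular_inverse_M_matrix (min_matrix x)"
    using P min_matrix_inverse_M_iff[OF n x] by simp
  have P_osc: "oscillatory (min_matrix x)" if P
    using min_matrix_oscillatory[OF n x] P that by blast
  have osc_tn: "invertible_mat (min_matrix x) \<and> totally_nonnegative (min_matrix x)"
    if "oscillatory (min_matrix x)"
    using oscillatory_imp_invertible[OF A n that] that by (simp add: oscillatory_def)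
  have tn_P: "P" if "invertible_mat (min_matrix x) \<and> totally_nonnegative (min_matrix x)"
    using min_matrix_invertible_totally_nonnegative_imp[OF n x] P that by blast
  show "P \<longleftrightarrow> invertible_mat (min_matrix x) \<and> totally_nonnegative (min_matrix x)"
    and "P \<longleftrightarrow> oscillatory (min_matrix x)"
    using P_osc osc_tn tn_P by blast+
qed

section \<open>Reversal of the index order\<close>

definition flip_vec :: "'a vec \<Rightarrow> 'a vec" where
  "flip_vec v = vec (dim_vec v) (\<lambda>i. v $ (dim_vec v - Suc i))"

text \<open>Conjugation by the exchange matrix, which reverses the order of the basis.\<close>
definition flip_mat :: "'a mat \<Rightarrow> 'a mat" where
  "flip_mat A = mat (dim_row A) (dim_col A)
     (\<lambda>(i, j). A $$ (dim_row A - Suc i, dim_col A - Suc j))"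

lemma flip_carrier [simp]:
  "v \<in> carrier_vec n \<Longrightarrow> flip_vec v \<in> carrier_vec n"
  "A \<in> carrier_mat n m \<Longrightarrow> flip_mat A \<in> carrier_mat n m"
  "dim_row (flip_mat A) = dim_row A" "dim_col (flip_mat A) = dim_col A"
  by (auto simp: flip_vec_def flip_mat_def)

lemma flip_flip [simp]: "flip_vec (flip_vec v) = v" "flip_mat (flip_mat A) = A"
  by (auto simp: flip_vec_def flip_mat_def intro!: eq_vecI eq_matI)

lemma flip_mat_one [simp]: "flip_mat (1\<^sub>m n) = (1\<^sub>m n :: 'a :: semiring_1 mat)"
  by (auto simp: flip_mat_def intro!: eq_matI)

lemma flip_mat_mult:
  fixes A B :: "'a :: comm_semiring_0 mat"
  assumes A: "A \<in> carrier_mat n n" and B: "B \<in> carrier_mat n n"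
  shows "flip_mat (A * B) = flip_mat A * flip_mat B"
proof (rule eq_matI)
  fix i j assume "i < dim_row (flip_mat A * flip_mat B)" "j < dim_col (flip_mat A * flip_mat B)"
  then have ij: "i < n" "j < n" using A B by auto
  have "(flip_mat A * flip_mat B) $$ (i, j)
      = (\<Sum>l<n. A $$ (n - Suc i, n - Suc l) * B $$ (n - Suc l, n - Suc j))"
    using ij A B by (auto simp: flip_mat_def scalar_prod_def atLeast0LessThan intro!: sum.cong)
  also have "\<dots> = (\<Sum>l<n. A $$ (n - Suc i, l) * B $$ (l, n - Suc j))"
    by (rule sum.nat_diff_reindex)
  also have "\<dots> = flip_mat (A * B) $$ (i, j)"
    using ij A B by (auto simp: flip_mat_def scalar_prod_def atLeast0LessThan intro!: sum.cong)
  finally show "flip_mat (A * B) $$ (i, j) = (flip_mat A * flip_mat B) $$ (i, j)" by simp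
qed (use A B in auto)

lemma flip_mat_pow:
  fixes A :: "'a :: comm_semiring_1 mat"
  assumes A: "A \<in> carrier_mat n n"
  shows "flip_mat (A ^\<^sub>m m) = flip_mat A ^\<^sub>m m"
  by (induction m) (use A flip_mat_mult[OF pow_carrier_mat[OF A] A] in auto)

text \<open>Reversing rows and columns of the submatrix applies the same permutation on both sides, and its
  sign cancels.\<close>
lemma minor_flip_mat:
  assumes A: "A \<in> carrier_mat n n" and f: "index_seq k n f" and g: "index_seq k n g"
  shows "minor (flip_mat A) k f g
       = minor A k (\<lambda>a. n - Suc (f (k - Suc a))) (\<lambda>a. n - Suc (g (k - Suc a)))"
proof -
  let ?r = "\<lambda>a. if a < k then k - Suc a else a"
  let ?N = "mat k k (\<lambda>(a, b). A $$ (n - Suc (f a), n - Suc (g b)))"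
  let ?N1 = "mat k k (\<lambda>(a, b). ?N $$ (?r a, b))"
  have "bij_betw ?r {0..<k} {0..<k}"
    by (rule bij_betw_byWitness[where f' = ?r]) auto
  then have r: "?r permutes {0..<k}" by (rule bij_imp_permutes) auto
  have N1: "det ?N1 = signof ?r * det ?N" by (rule det_permute_rows[OF _ r]) simp
  have "mat k k (\<lambda>(a, b). A $$ (n - Suc (f (k - Suc a)), n - Suc (g (k - Suc b))))
      = transpose_mat (mat k k (\<lambda>(a, b). transpose_mat ?N1 $$ (?r a, b)))"
    by (rule eq_matI) auto
  then have "minor A k (\<lambda>a. n - Suc (f (k - Suc a))) (\<lambda>a. n - Suc (g (k - Suc a)))
      = det (mat k k (\<lambda>(a, b). transpose_mat ?N1 $$ (?r a, b)))"
    unfolding minor_def by (simp only: det_transpose[OF mat_carrier])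
  also have "\<dots> = signof ?r * det (transpose_mat ?N1)" by (rule det_permute_rows[OF _ r]) simp
  also have "det (transpose_mat ?N1) = det ?N1" by (rule det_transpose[OF mat_carrier])
  finally have "minor A k (\<lambda>a. n - Suc (f (k - Suc a))) (\<lambda>a. n - Suc (g (k - Suc a)))
      = (signof ?r * signof ?r) * det ?N" unfolding N1 by (simp add: mult.assoc)
  also have "signof ?r * signof ?r = (1 :: 'a)" by (simp add: sign_def)
  also have "?N = mat k k (\<lambda>(a, b). flip_mat A $$ (f a, g b))"
    by (rule eq_matI) (use A index_seqD(1)[OF f] index_seqD(1)[OF g] in \<open>auto simp: flip_mat_def\<close>)
  finally show ?thesis by (simp add: minor_def)
qed

lemma index_seq_flip:
  assumes f: "index_seq k n f"
  shows "index_seq k n (\<lambda>a. n - Suc (f (k - Suc a)))"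
proof (rule index_seqI)
  fix a assume "a < k"
  then have "f (k - Suc a) < n" by (intro index_seqD(1)[OF f]) auto
  then show "n - Suc (f (k - Suc a)) < n" by simp
next
  fix a b assume "a < b" "b < k"
  then have "f (k - Suc b) < f (k - Suc a)" "f (k - Suc a) < n"
    by (auto intro!: index_seqD[OF f])
  then show "n - Suc (f (k - Suc a)) < n - Suc (f (k - Suc b))" by simp
qed

lemma minors_flip_mat:
  assumes A: "A \<in> carrier_mat n n"
  shows "minors (flip_mat A) = minors A"
proof -
  have sub: "minors (flip_mat B) \<subseteq> minors B" if B: "B \<in> carrier_mat n n" for B :: "real mat"
  proof
    fix d assume "d \<in> minors (flip_mat B)"
    then obtain k f g where *: "d = minor (flip_mat B) k f g" "1 \<le> k"
      "index_seq k n f" "index_seq k n g"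
      using B unfolding minors_eq by auto
    then have "d = minor B k (\<lambda>a. n - Suc (f (k - Suc a))) (\<lambda>a. n - Suc (g (k - Suc a)))"
      using minor_flip_mat[OF B] by simp
    moreover note index_seq_flip[OF *(3)] index_seq_flip[OF *(4)]
    ultimately show "d \<in> minors B" unfolding minors_eq using *(2) B by blast
  qed
  from sub[OF A] sub[of "flip_mat A"] A show ?thesis by simp
qed

lemma totally_nonnegative_flip_mat:
  "A \<in> carrier_mat n n \<Longrightarrow> totally_nonnegative (flip_mat A) \<longleftrightarrow> totally_nonnegative A"
  by (simp add: totally_nonnegative_def minors_flip_mat)

lemma oscillatory_flip_mat:
  assumes A: "A \<in> carrier_mat n n"
  shows "oscillatory (flip_mat A) \<longleftrightarrow> oscillatory A"
  using A minors_flip_mat[OF pow_carrier_mat[OF A]]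
  by (simp add: oscillatory_def totally_nonnegative_flip_mat totally_positive_def
      flip_mat_pow[OF A, symmetric])

lemma invertible_flip_mat:
  assumes A: "A \<in> carrier_mat n n"
  shows "invertible_mat (flip_mat A) \<longleftrightarrow> invertible_mat (A :: real mat)"
proof -
  have *: "minor (flip_mat A) n id id = minor A n (\<lambda>a. n - Suc (id (n - Suc a))) (\<lambda>a. n - Suc (id (n - Suc a)))"
    by (rule minor_flip_mat[OF A]) (auto intro: index_seqI)
  also have "\<dots> = minor A n id id" by (rule minor_cong) auto
  finally have "det (flip_mat A) = det A" using A by (simp add: minor_full)
  then show ?thesis using A by (simp add: invertible_iff_det[where n = n])
qed

lemma nonsingular_inverse_M_matrix_flip_mat:
  assumes A: "A \<in> carrier_mat n n"
  shows "nonsingular_inverse_M_matrix (flip_mat A) \<longleftrightarrow> nonsingular_inverse_M_matrix A"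
proof -
  have imp: "nonsingular_inverse_M_matrix (flip_mat A)"
    if A: "A \<in> carrier_mat n n" and M: "nonsingular_inverse_M_matrix A" for A
  proof -
    obtain B where B: "B \<in> carrier_mat n n" "A * B = 1\<^sub>m n" "B * A = 1\<^sub>m n" "Z_matrix B"
      and nonneg: "entrywise_nonnegative A"
      using M unfolding nonsingular_inverse_M_matrix_iff[OF A] by blast
    have "flip_mat A * flip_mat B = 1\<^sub>m n" "flip_mat B * flip_mat A = 1\<^sub>m n"
      by (simp_all add: flip_mat_mult[OF A B(1), symmetric] flip_mat_mult[OF B(1) A, symmetric] B)
    moreover have "Z_matrix (flip_mat B)"
      using B(1,4) unfolding Z_matrix_def by (auto simp: flip_mat_def)
    moreover have "entrywise_nonnegative (flip_mat A)"
      using A nonneg unfolding entrywise_nonnegative_def by (auto simp: flip_mat_def)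
    ultimately show ?thesis
      using A B(1) by (subst nonsingular_inverse_M_matrix_iff[where n = n]) auto
  qed
  from imp[OF A] imp[of "flip_mat A"] A show ?thesis by auto
qed

lemma positive_definite_flip_mat:
  assumes A: "A \<in> carrier_mat n n"
  shows "positive_definite (flip_mat A) \<longleftrightarrow> positive_definite A"
proof -
  have imp: "positive_definite (flip_mat A)"
    if A: "A \<in> carrier_mat n n" and pd: "positive_definite A" for A :: "real mat"
    unfolding positive_definite_def
  proof (intro conjI ballI impI)
    show "square_mat (flip_mat A)" using A by simp
    have "transpose_mat (flip_mat A) = flip_mat (transpose_mat A)"
      using A by (auto simp: flip_mat_def intro!: eq_matI)
    then show "transpose_mat (flip_mat A) = flip_mat A"
      using pd by (simp add: positive_definite_def)
    fix v :: "real vec"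
    assume "v \<in> carrier_vec (dim_row (flip_mat A))" "v \<noteq> 0\<^sub>v (dim_row (flip_mat A))"
    then have v: "v \<in> carrier_vec n" "v \<noteq> 0\<^sub>v n" using A by auto
    have "flip_vec v \<noteq> 0\<^sub>v n"
    proof
      assume "flip_vec v = 0\<^sub>v n"
      then have "flip_vec (flip_vec v) = flip_vec (0\<^sub>v n)" by simp
      then have "v = flip_vec (0\<^sub>v n)" by simp
      also have "\<dots> = 0\<^sub>v n" by (auto simp: flip_vec_def intro!: eq_vecI)
      finally show False using v by simp
    qed
    then have "0 < flip_vec v \<bullet> (A *\<^sub>v flip_vec v)"
      using pd A v unfolding positive_definite_def by auto
    also have "\<dots> = (\<Sum>i<n. v $ (n - Suc i) * (\<Sum>j<n. A $$ (i, j) * v $ (n - Suc j)))"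
      using A v by (auto simp: flip_vec_def scalar_prod_def atLeast0LessThan intro!: sum.cong)
    also have "\<dots> = (\<Sum>i<n. v $ (n - Suc (n - Suc i)) *
        (\<Sum>j<n. A $$ (n - Suc i, j) * v $ (n - Suc j)))"
      by (rule sum.nat_diff_reindex[symmetric])
    also have "\<dots> = (\<Sum>i<n. v $ i * (\<Sum>j<n. A $$ (n - Suc i, n - Suc j) * v $ j))"
    proof (rule sum.cong[OF refl])
      fix i assume i: "i \<in> {..<n}"
      have "(\<Sum>j<n. A $$ (n - Suc i, j) * v $ (n - Suc j))
          = (\<Sum>j<n. A $$ (n - Suc i, n - Suc j) * v $ (n - Suc (n - Suc j)))"
        by (rule sum.nat_diff_reindex[symmetric])
      also have "\<dots> = (\<Sum>j<n. A $$ (n - Suc i, n - Suc j) * v $ j)"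
        by (rule sum.cong) auto
      finally show "v $ (n - Suc (n - Suc i)) * (\<Sum>j<n. A $$ (n - Suc i, j) * v $ (n - Suc j))
          = v $ i * (\<Sum>j<n. A $$ (n - Suc i, n - Suc j) * v $ j)"
        using i by simp
    qed
    also have "\<dots> = v \<bullet> (flip_mat A *\<^sub>v v)"
      using A v by (auto simp: flip_mat_def scalar_prod_def atLeast0LessThan intro!: sum.cong)
    finally show "0 < v \<bullet> (flip_mat A *\<^sub>v v)" .
  qed
  from imp[OF A] imp[of "flip_mat A"] A show ?thesis by auto
qed

section \<open>The Max matrix and the equivalences\<close>

lemma max_matrix_eq_flip:
  assumes x: "x \<in> carrier_vec n"
  shows "max_matrix x = flip_mat (min_matrix (flip_vec x))"
proof (rule eq_matI)
  fix i j assume "i < dim_row (flip_mat (min_matrix (flip_vec x)))"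
    "j < dim_col (flip_mat (min_matrix (flip_vec x)))"
  then have ij: "i < n" "j < n" using x by (auto simp: min_matrix_def flip_vec_def)
  then have "n - Suc (min (n - Suc i) (n - Suc j)) = max i j" by (auto simp: min_def max_def)
  then show "max_matrix x $$ (i, j) = flip_mat (min_matrix (flip_vec x)) $$ (i, j)"
    using ij x by (simp add: max_matrix_def min_matrix_def flip_mat_def flip_vec_def)
qed (use x in \<open>auto simp: max_matrix_def min_matrix_def flip_vec_def\<close>)

lemma flip_vec_increasing_iff:
  assumes n: "1 \<le> n" and x: "x \<in> carrier_vec n"
  shows "0 < flip_vec x $ 0 \<and> (\<forall>i. Suc i < n \<longrightarrow> flip_vec x $ i < flip_vec x $ Suc i)
    \<longleftrightarrow> (\<forall>i. Suc i < n \<longrightarrow> x $ i > x $ Suc i) \<and> x $ (n - 1) > (0 :: real)"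
proof -
  have "(\<forall>i. Suc i < n \<longrightarrow> flip_vec x $ i < flip_vec x $ Suc i)
      \<longleftrightarrow> (\<forall>i. Suc i < n \<longrightarrow> x $ (n - Suc i) < x $ (n - Suc (Suc i)))"
    using x by (auto simp: flip_vec_def)
  also have "\<dots> \<longleftrightarrow> (\<forall>i. Suc i < n \<longrightarrow> x $ Suc i < x $ i)"
  proof (intro iffI allI impI)
    fix i assume *: "\<forall>i. Suc i < n \<longrightarrow> x $ (n - Suc i) < x $ (n - Suc (Suc i))" and i: "Suc i < n"
    have "n - Suc (n - Suc (Suc i)) = Suc i" "n - Suc (Suc (n - Suc (Suc i))) = i" using i by auto
    then show "x $ Suc i < x $ i" using *[rule_format, of "n - Suc (Suc i)"] i by simp
  next
    fix i assume *: "\<forall>i. Suc i < n \<longrightarrow> x $ Suc i < x $ i" and i: "Suc i < n"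
    have "Suc (n - Suc (Suc i)) = n - Suc i" using i by simp
    then show "x $ (n - Suc i) < x $ (n - Suc (Suc i))" using *[rule_format, of "n - Suc (Suc i)"] i by simp
  qed
  moreover have "flip_vec x $ 0 = x $ (n - 1)" using n x by (simp add: flip_vec_def)
  ultimately show ?thesis by auto
qed

theorem theorem4p4:
  fixes n :: nat and x :: "real vec"
  assumes "1 \<le> n" and "x \<in> carrier_vec n"
  shows
    "(let A = min_matrix x;
          P = (0 < x $ 0 \<and> (\<forall>i. Suc i < n \<longrightarrow> x $ i < x $ Suc i))
      in (P \<longleftrightarrow> positive_definite A) \<and>
         (P \<longleftrightarrow> invertible_mat A \<and> totally_nonnegative A) \<and>
         (P \<longleftrightarrow> nonsingular_inverse_M_matrix A) \<and>
         (P \<longleftrightarrow> oscillatory A)) \<and>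
     (let A = max_matrix x;
          P = ((\<forall>i. Suc i < n \<longrightarrow> x $ i > x $ Suc i) \<and> x $ (n - 1) > 0)
      in (P \<longleftrightarrow> positive_definite A) \<and>
         (P \<longleftrightarrow> invertible_mat A \<and> totally_nonnegative A) \<and>
         (P \<longleftrightarrow> nonsingular_inverse_M_matrix A) \<and>
         (P \<longleftrightarrow> oscillatory A))"
proof -
  have y: "flip_vec x \<in> carrier_vec n" using assms by simp
  then have A: "min_matrix (flip_vec x) \<in> carrier_mat n n" by simp
  show ?thesis
    unfolding Let_def max_matrix_eq_flip[OF assms(2)]
      positive_definite_flip_mat[OF A] invertible_flip_mat[OF A] totally_nonnegative_flip_mat[OF A]
      nonsingular_inverse_M_matrix_flip_mat[OF A] oscillatory_flip_mat[OF A]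
      flip_vec_increasing_iff[OF assms, symmetric]
    using min_matrix_characterization[OF assms] min_matrix_characterization[OF assms(1) y]
    by (intro conjI)
qed

end
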